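(* Let $\mathbb{A}$ be a nonnegative tensor of order $m\ge 2$ and dimension $n$. Then $\mathbb{A}$ is primitive if and only if there exists some positive integer $r$ such that $\mathbb{A}^r$ is essentially positive. Furthermore, the smallest such $r$ is the primitive degree of $\mathbb{A}$.
   Context: Write $[n]=\{1,\dots,n\}$. An order $m$ dimension $n$ tensor is an array indexed by $[n]^m$; it is nonnegative if all entries are real and $\ge 0$. For vectors, $x>0$ means all components are positive. General tensor product: if $\mathbb{A}$ has order $p\ge 2$ and $\mathbb{B}$ has order $q\ge 1$, both of dimension $n$, then $\mathbb{A}\mathbb{B}$ is the tensor of order $(p-1)(q-1)+1$ and dimension $n$ with $$(\mathbb{A}\mathbb{B})_{i\alpha_1\cdots\alpha_{p-1}}=\sum_{i_2,\dots,i_p=1}^n a_{ii_2\cdots i_p}\,b_{i_2\alpha_1}\cdots b_{i_p\alpha_{p-1}}\qquad(i\in[n],\ \alpha_1,\dots,\alpha_{p-1}\in[n]^{q-1}).$$ In particular, for a vector $x$, $(\mathbb{A}x)_i=\sum a_{ii_2\cdots i_p}x_{i_2}\cdots x_{i_p}$. This product is associative, and $\mathbb{A}^r$ denotes the product of $r$ copies of $\mathbb{A}$ (a tensor of order $(m-1)^r+1$). A nonnegative tensor $\mathbb{A}$ of dimension $n$ is essentially positive if $\mathbb{A}x>0$ for every nonnegative nonzero vector $x\in\mathbb{R}^n$ (equivalently $a_{ij\cdots j}>0$ for all $i,j\in[n]$). For nonnegative $\mathbb{A}$ of order $m$, let $T_{\mathbb{A}}(x)=(\mathbb{A}x)^{[\frac{1}{m-1}]}$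 (componentwise $(m-1)$-th root) for nonnegative vectors $x\in\mathbb{R}^n$. $\mathbb{A}$ is primitive if there is a positive integer $r$ with $T_{\mathbb{A}}^r(x)>0$ for all nonnegative nonzero $x\in\mathbb{R}^n$ ($T_{\mathbb{A}}^r$ is the $r$-fold iterate); the smallest such $r$ is the primitive degree $\gamma(\mathbb{A})$. *)

theory Defs
  imports "HOL-Analysis.Analysis"
begin

text \<open>
  The index set of the tensors is a finite type, whose cardinality is the dimension.
  The order is part of the value, since it changes under multiplication.  An index tuple
  is a list, and only the entries at lists whose length equals the order are meaningful.
\<close>

datatype 'n tensor = Tensor (tensor_order: nat) (entry: "'n list \<Rightarrow> real")

definition nonneg_tensor :: "'n tensor \<Rightarrow> bool" where
  "nonneg_tensor A \<longleftrightarrow> (\<forall>ix. length ix = tensor_order A \<longrightarrow> 0 \<le> entry A ix)"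

definition block :: "nat \<Rightarrow> 'a list \<Rightarrow> nat \<Rightarrow> 'a list" where
  "block l xs k = take l (drop (k * l) xs)"

text \<open>
  The general product, for \<open>A\<close> of order at least 2 and \<open>B\<close> of order at least 1.  The index
  tuple is \<open>i\<close> followed by the concatenation of \<open>\<alpha>\<^sub>1, \<dots>\<close>, which \<open>block\<close> (counting
  from 0) recovers; see \<open>entry_tensor_mult\<close> below.
\<close>

definition tensor_mult :: "'n::finite tensor \<Rightarrow> 'n tensor \<Rightarrow> 'n tensor" where
  "tensor_mult A B =
     (let p = tensor_order A; q = tensor_order B in
      Tensor ((p - 1) * (q - 1) + 1)
        (\<lambda>ix. \<Sum>js | length js = p - 1.
            entry A (hd ix # js) *
            (\<Prod>k<p - 1. entry B (js ! k # block (q - 1) (tl ix) k))))"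

lemma block_concat:
  assumes "\<forall>a \<in> set as. length a = l" and "k < length as"
  shows "block l (concat as) k = as ! k"
  using assms
proof (induction as arbitrary: k)
  case Nil
  then show ?case by simp
next
  case (Cons a as)
  then show ?case by (cases k) (auto simp: block_def)
qed

lemma entry_tensor_mult:
  assumes "length as = tensor_order A - 1"
    and "\<forall>a \<in> set as. length a = tensor_order B - 1"
  shows "entry (tensor_mult A B) (i # concat as) =
    (\<Sum>js | length js = tensor_order A - 1.
       entry A (i # js) * (\<Prod>k<tensor_order A - 1. entry B (js ! k # as ! k)))"
  using assms by (simp add: tensor_mult_def Let_def block_concat)

definition tensor_vec :: "'n::finite tensor \<Rightarrow> real ^ 'n \<Rightarrow> real ^ 'n" where
  "tensor_vec A x =
     (\<chi> i. \<Sum>js | length js = tensor_order A - 1.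
         entry A (i # js) * (\<Prod>k<tensor_order A - 1. x $ (js ! k)))"

text \<open>This is the general product with a vector regarded as a tensor of order 1.\<close>

lemma tensor_vec_eq_tensor_mult:
  "tensor_vec A x $ i = entry (tensor_mult A (Tensor 1 (\<lambda>ix. x $ hd ix))) [i]"
  by (simp add: tensor_vec_def tensor_mult_def Let_def)

text \<open>
  Products of one or more copies.  The value at exponent 0 is the identity matrix; it is
  only there to make the function total.
\<close>

fun tensor_power :: "'n::finite tensor \<Rightarrow> nat \<Rightarrow> 'n tensor" where
  "tensor_power A 0 = Tensor 2 (\<lambda>ix. if ix ! 0 = ix ! 1 then 1 else 0)"
| "tensor_power A (Suc 0) = A"
| "tensor_power A (Suc (Suc r)) = tensor_mult A (tensor_power A (Suc r))"

lemma tensor_order_tensor_power: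
  assumes "tensor_order A \<ge> 1"
  shows "tensor_order (tensor_power A r) = (tensor_order A - 1) ^ r + 1"
  using assms
  by (induction A r rule: tensor_power.induct) (auto simp: tensor_mult_def Let_def)

text \<open>
  The library order on \<^typ>\<open>real ^ 'n\<close> is componentwise for \<open>\<le>\<close>, but its strict part does
  not require every component to be strictly larger, hence a separate predicate.
\<close>

definition pos_vec :: "real ^ 'n \<Rightarrow> bool" where
  "pos_vec x \<longleftrightarrow> (\<forall>i. 0 < x $ i)"

definition nonneg_vec :: "real ^ 'n \<Rightarrow> bool" where
  "nonneg_vec x \<longleftrightarrow> (\<forall>i. 0 \<le> x $ i)"

definition essentially_positive :: "'n::finite tensor \<Rightarrow> bool" where
  "essentially_positive A \<longleftrightarrow>
     nonneg_tensor A \<and> (\<forall>x. nonneg_vec x \<and> x \<noteq> 0 \<longrightarrow> pos_vec (tensor_vec A x))"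

definition tensor_map :: "'n::finite tensor \<Rightarrow> real ^ 'n \<Rightarrow> real ^ 'n" where
  "tensor_map A x = (\<chi> i. root (tensor_order A - 1) (tensor_vec A x $ i))"

definition primitive_at :: "'n::finite tensor \<Rightarrow> nat \<Rightarrow> bool" where
  "primitive_at A r \<longleftrightarrow>
     (\<forall>x. nonneg_vec x \<and> x \<noteq> 0 \<longrightarrow> pos_vec ((tensor_map A ^^ r) x))"

definition primitive :: "'n::finite tensor \<Rightarrow> bool" where
  "primitive A \<longleftrightarrow> nonneg_tensor A \<and> (\<exists>r>0. primitive_at A r)"

definition primitive_degree :: "'n::finite tensor \<Rightarrow> nat" where
  "primitive_degree A = (LEAST r. 0 < r \<and> primitive_at A r)"

end

(* The product with a vector is associative, so the tensor power A^r acts on vectors as the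
   r-fold iterate of x \<mapsto> A x. For nonnegative data the support of A x depends only on the
   support of x, and taking roots does not change supports. So T_A^r(x) and A^r x have the same
   support, and the two positivity conditions agree for each single r. *)

theory Submission
  imports Defs
begin

lemma length_block:
  assumes "length xs = n * l" and "k < n"
  shows "length (block l xs k) = l"
proof -
  have "Suc k * l \<le> n * l"
    using assms(2) by (intro mult_le_mono1) simp
  then show ?thesis
    using assms(1) by (simp add: block_def)
qed

lemma nth_block: "k * l \<le> length xs \<Longrightarrow> s < l \<Longrightarrow> block l xs k ! s = xs ! (k * l + s)"
  by (simp add: block_def)

lemma block_append_0: "length a = l \<Longrightarrow> block l (a @ xs) 0 = a"
  by (simp add: block_def)

lemma block_append_Suc: "length a = l \<Longrightarrow> block l (a @ xs) (Suc k) = block l xs k"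
  by (simp add: block_def)

lemma finite_length_eq: "finite {xs :: 'n::finite list. length xs = k}"
  using finite_lists_length_eq[of "UNIV :: 'n set" k] by simp

lemma sum_length_add:
  fixes f :: "'n::finite list \<Rightarrow> 'b::comm_monoid_add"
  shows "(\<Sum>xs | length xs = k + l. f xs) =
    (\<Sum>a | length a = k. \<Sum>b | length b = l. f (a @ b))"
proof -
  have "(\<Sum>xs | length xs = k + l. f xs) =
      (\<Sum>(a, b) \<in> {a. length a = k} \<times> {b. length b = l}. f (a @ b))"
    by (rule sum.reindex_bij_witness
        [where i = "\<lambda>(a, b). a @ b" and j = "\<lambda>xs. (take k xs, drop k xs)"]) auto
  then show ?thesis
    by (simp add: sum.cartesian_product)
qed

text \<open>Distributivity: choosing one tuple of length \<open>l\<close> for each of the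
  \<open>n\<close> factors amounts to choosing their concatenation, whose blocks return the
  individual choices.\<close>

lemma prod_sum_block:
  fixes f :: "nat \<Rightarrow> 'n::finite list \<Rightarrow> 'b::comm_semiring_1"
  shows "(\<Prod>k<n. \<Sum>a | length a = l. f k a) =
    (\<Sum>xs | length xs = n * l. \<Prod>k<n. f k (block l xs k))"
proof (induction n arbitrary: f)
  case 0
  then show ?case by simp
next
  case (Suc n)
  \<comment> \<open>The first factor is split off, not the last, because \<open>block\<close> is
    easy to follow when a tuple is prepended. The later factors move down by one index, so the
    induction hypothesis is used with \<open>f\<close> shifted, hence arbitrary.\<close>
  have "(\<Prod>k<Suc n. \<Sum>a | length a = l. f k a) =
      (\<Sum>a | length a = l. f 0 a) * (\<Sum>xs | length xs = n * l. \<Prod>k<n. f (Suc k) (block l xs k))"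
    by (simp only: prod.lessThan_Suc_shift Suc.IH)
  also have "\<dots> = (\<Sum>a | length a = l. \<Sum>xs | length xs = n * l.
      \<Prod>k<Suc n. f k (block l (a @ xs) k))"
    by (simp add: sum_product prod.lessThan_Suc_shift block_append_0 block_append_Suc
        del: prod.lessThan_Suc)
  also have "\<dots> = (\<Sum>xs | length xs = Suc n * l. \<Prod>k<Suc n. f k (block l xs k))"
    by (simp add: sum_length_add del: prod.lessThan_Suc)
  finally show ?case .
qed

text \<open>Position \<open>t\<close> is written as \<open>k * l + s\<close>. This cuts the monomial
  in the vector into pieces, each of which can be paired with the factor of the second tensor that
  carries the same block.\<close>

lemma prod_nth_block:
  fixes x :: "'a \<Rightarrow> 'b::comm_monoid_mult"
  assumes "length xs = n * l"
  shows "(\<Prod>t<n * l. x (xs ! t)) = (\<Prod>k<n. \<Prod>s<l. x (block l xs k ! s))"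
proof -
  have "(\<Prod>t<n * l. x (xs ! t)) = (\<Prod>k<n. \<Prod>t = k * l..<k * l + l. x (xs ! t))"
    by (simp add: prod.nat_group)
  also have "\<dots> = (\<Prod>k<n. \<Prod>s<l. x (block l xs k ! s))"
  proof (rule prod.cong[OF refl])
    fix k assume "k \<in> {..<n}"
    then have "k * l \<le> length xs"
      using assms by simp
    then show "(\<Prod>t = k * l..<k * l + l. x (xs ! t)) = (\<Prod>s<l. x (block l xs k ! s))"
      using prod.shift_bounds_nat_ivl[of "\<lambda>t. x (xs ! t)" 0 "k * l" l]
      by (simp add: nth_block atLeast0LessThan add.commute)
  qed
  finally show ?thesis .
qed

text \<open>The instance of associativity in which the last factor is a vector. Both sides expand to
  one double sum, over \<open>js\<close> for \<open>A\<close> and over the concatenated index tuple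
  \<open>xs\<close> for the copies of \<open>B\<close>.\<close>

lemma tensor_vec_tensor_mult:
  "tensor_vec (tensor_mult A B) x = tensor_vec A (tensor_vec B x)"
proof -
  define n where "n = tensor_order A - 1"
  define l where "l = tensor_order B - 1"
  have "tensor_vec (tensor_mult A B) x $ i = tensor_vec A (tensor_vec B x) $ i" for i
  proof -
    have "tensor_vec (tensor_mult A B) x $ i =
        (\<Sum>xs | length xs = n * l.
          (\<Sum>js | length js = n. entry A (i # js) * (\<Prod>k<n. entry B (js ! k # block l xs k))) *
          (\<Prod>k<n. \<Prod>s<l. x $ (block l xs k ! s)))"
      by (simp add: tensor_vec_def tensor_mult_def Let_def del: One_nat_def flip: n_def l_def prod_nth_block)
    also have "\<dots> = (\<Sum>js | length js = n. \<Sum>xs | length xs = n * l. entry A (i # js) *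
        (\<Prod>k<n. entry B (js ! k # block l xs k) * (\<Prod>s<l. x $ (block l xs k ! s))))"
      by (subst sum.swap) (simp add: sum_distrib_right prod.distrib mult.assoc)
    \<comment> \<open>For fixed \<open>js\<close> the blocks of \<open>xs\<close> vary
      independently, so the inner sum factors; the factor with number \<open>k\<close> is the
      component of \<open>tensor_vec B x\<close> at \<open>js ! k\<close>.\<close>
    also have "\<dots> = (\<Sum>js | length js = n. entry A (i # js) *
        (\<Prod>k<n. \<Sum>a | length a = l. entry B (js ! k # a) * (\<Prod>s<l. x $ (a ! s))))"
      by (simp only: prod_sum_block sum_distrib_left)
    also have "\<dots> = tensor_vec A (tensor_vec B x) $ i"
      by (simp add: tensor_vec_def del: One_nat_def flip: n_def l_def)
    finally show ?thesis .
  qed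
  then show ?thesis
    by (simp add: vec_eq_iff)
qed

lemma tensor_vec_tensor_power:
  "tensor_vec (tensor_power A (Suc r)) x = (tensor_vec A ^^ Suc r) x"
  by (induction r) (simp_all add: tensor_vec_tensor_mult)

lemma nonneg_tensor_mult:
  assumes "nonneg_tensor A" "nonneg_tensor B" "tensor_order A \<ge> 1" "tensor_order B \<ge> 1"
  shows "nonneg_tensor (tensor_mult A B)"
proof -
  define n where "n = tensor_order A - 1"
  define l where "l = tensor_order B - 1"
  have A: "0 \<le> entry A (i # js)" if "length js = n" for i js
    using assms(1,3) that by (simp add: nonneg_tensor_def n_def)
  have B: "0 \<le> entry B (i # js)" if "length js = l" for i js
    using assms(2,4) that by (simp add: nonneg_tensor_def l_def)
  \<comment> \<open>Entries of \<open>B\<close> have a known sign only at tuples of the right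
    length, so the blocks must be full.\<close>
  have "length (block l (tl ix) k) = l" if "length ix = n * l + 1" "k < n" for ix :: "'a list" and k
    using that by (intro length_block) auto
  then show ?thesis
    unfolding nonneg_tensor_def tensor_mult_def Let_def n_def[symmetric] l_def[symmetric]
    by (auto simp del: One_nat_def intro!: sum_nonneg mult_nonneg_nonneg prod_nonneg A B)
qed

lemma nonneg_tensor_power:
  assumes "tensor_order A \<ge> 1" "nonneg_tensor A"
  shows "nonneg_tensor (tensor_power A r)"
  using assms
proof (induction A r rule: tensor_power.induct)
  case (1 A)
  then show ?case by (simp add: nonneg_tensor_def)
next
  case (2 A)
  then show ?case by simp
next
  case (3 A r)
  then show ?case
    by (auto simp: tensor_order_tensor_power simp del: power_Suc intro!: nonneg_tensor_mult)
qed

lemma nonneg_tensor_vec: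
  assumes "tensor_order A \<ge> 1" "nonneg_tensor A" "nonneg_vec x"
  shows "nonneg_vec (tensor_vec A x)"
  using assms unfolding nonneg_tensor_def nonneg_vec_def
  by (auto simp: tensor_vec_def intro!: sum_nonneg mult_nonneg_nonneg prod_nonneg)

text \<open>A finite sum of nonnegative terms is positive exactly when some term is nonzero. The
  resulting criterion sees \<open>x\<close> only through the set of its positive components.\<close>

lemma tensor_vec_pos_iff:
  assumes "tensor_order A \<ge> 1" "nonneg_tensor A" "nonneg_vec x"
  shows "0 < tensor_vec A x $ i \<longleftrightarrow>
    (\<exists>js. length js = tensor_order A - 1 \<and> 0 < entry A (i # js) \<and>
      (\<forall>k<tensor_order A - 1. 0 < x $ (js ! k)))"
proof -
  define n where "n = tensor_order A - 1"
  have A: "0 \<le> entry A (i # js)" if "length js = n" for js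
    using assms(1,2) that by (simp add: nonneg_tensor_def n_def)
  have x: "0 \<le> x $ j" for j
    using assms(3) by (simp add: nonneg_vec_def)
  define t where "t js = entry A (i # js) * (\<Prod>k<n. x $ (js ! k))" for js
  have t: "0 \<le> t js" if "js \<in> {js. length js = n}" for js
    using A that x by (simp add: t_def prod_nonneg)
  have "tensor_vec A x $ i = sum t {js. length js = n}"
    by (simp add: tensor_vec_def t_def n_def)
  then have "0 < tensor_vec A x $ i \<longleftrightarrow> sum t {js. length js = n} \<noteq> 0"
    using sum_nonneg[of "{js. length js = n}" t] t by auto
  also have "\<dots> \<longleftrightarrow> (\<exists>js. length js = n \<and> t js \<noteq> 0)"
    using sum_nonneg_eq_0_iff[of "{js. length js = n}" t] t finite_length_eq by blast
  also have "\<dots> \<longleftrightarrow> (\<exists>js. length js = n \<and> 0 < entry A (i # js) \<and> (\<forall>k<n. 0 < x $ (js ! k)))"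
    using A x by (auto simp: t_def less_le)
  finally show ?thesis
    by (simp only: n_def)
qed

text \<open>The iterates may differ in value; only their positive components are compared.
  Nonnegativity is carried through the induction because the positivity criterion applies to
  nonnegative vectors.\<close>

lemma support_tensor_map_funpow:
  assumes "tensor_order A \<ge> 2" "nonneg_tensor A" "nonneg_vec x"
  shows "nonneg_vec ((tensor_map A ^^ r) x) \<and> nonneg_vec ((tensor_vec A ^^ r) x) \<and>
    (\<forall>i. 0 < (tensor_map A ^^ r) x $ i \<longleftrightarrow> 0 < (tensor_vec A ^^ r) x $ i)"
proof (induction r)
  case 0
  then show ?case using assms(3) by simp
next
  case (Suc r)
  let ?y = "(tensor_map A ^^ r) x" and ?z = "(tensor_vec A ^^ r) x"
  \<comment> \<open>A root of positive index preserves the sign, whereas \<open>root 0\<close> is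
    constantly 0.\<close>
  have order: "tensor_order A \<ge> 1" "tensor_order A - 1 > 0"
    using assms(1) by auto
  have "nonneg_vec (tensor_vec A ?y)" "nonneg_vec (tensor_vec A ?z)"
    using Suc order(1) assms(2) by (simp_all add: nonneg_tensor_vec)
  moreover have "0 < tensor_vec A ?y $ i \<longleftrightarrow> 0 < tensor_vec A ?z $ i" for i
    using Suc tensor_vec_pos_iff[OF order(1) assms(2), of ?y]
      tensor_vec_pos_iff[OF order(1) assms(2), of ?z] by simp
  moreover have "tensor_map A ?y $ i = root (tensor_order A - 1) (tensor_vec A ?y $ i)" for i
    by (simp add: tensor_map_def)
  ultimately show ?case
    using order(2) by (simp add: nonneg_vec_def)
qed

lemma essentially_positive_power_iff:
  assumes "tensor_order A \<ge> 2" "nonneg_tensor A" "r > 0"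
  shows "essentially_positive (tensor_power A r) \<longleftrightarrow> primitive_at A r"
proof -
  have "nonneg_tensor (tensor_power A r)"
    using assms by (simp add: nonneg_tensor_power)
  moreover have "pos_vec (tensor_vec (tensor_power A r) x) \<longleftrightarrow> pos_vec ((tensor_map A ^^ r) x)"
    if "nonneg_vec x" for x
    \<comment> \<open>The formula for powers is stated for successors; since \<open>r > 0\<close>,
      the exponent \<open>r\<close> is the successor of \<open>r - 1\<close>.\<close>
    using support_tensor_map_funpow[OF assms(1,2) that, of r]
      tensor_vec_tensor_power[of A "r - 1" x] assms(3)
    by (simp add: pos_vec_def)
  ultimately show ?thesis
    by (auto simp: essentially_positive_def primitive_at_def)
qed

theorem theorem4p1:
  fixes A :: "'n::finite tensor"
  assumes "tensor_order A \<ge> 2" and "nonneg_tensor A"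
  shows "(primitive A \<longleftrightarrow> (\<exists>r>0. essentially_positive (tensor_power A r))) \<and>
         (primitive A \<longrightarrow>
            (LEAST r. 0 < r \<and> essentially_positive (tensor_power A r)) = primitive_degree A)"
proof -
  \<comment> \<open>The two conditions select the same set of exponents, which settles both the
    existence claim and the equality of the least elements.\<close>
  have "0 < r \<and> essentially_positive (tensor_power A r) \<longleftrightarrow> 0 < r \<and> primitive_at A r" for r
    using essentially_positive_power_iff[OF assms] by blast
  then show ?thesis
    using assms(2) by (simp add: primitive_def primitive_degree_def)
qed

end
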